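(* If $\mathbf{K}$ is a cancellative monoid, $\mathbf{A}$ is a residuated chain, $\varphi:K\to\mathbf{ResEnd}(\mathbf{A})$, $k\mapsto\varphi_k$, is a map, and $f:K\times K\to A$ is a $2$-cocycle with respect to $\mathbf{K}$, $\mathbf{A}$ and $\varphi$, then $\mathbf{R}_{\varphi,f}$ is the reduct of a residuated lattice.
   Context: A residuated lattice is an algebra $(R,\wedge,\vee,\cdot,\backslash,/,1)$ such that $(R,\wedge,\vee)$ is a lattice, $(R,\cdot,1)$ is a monoid, and $xy\le z \iff y\le x\backslash z \iff x\le z/y$ for all $x,y,z$. A residuated chain is a residuated lattice whose order is total. A map $g:\mathbf{P}\to\mathbf{Q}$ between posets is residuated if there is $g^*:\mathbf{Q}\to\mathbf{P}$ with $g(x)\le y\iff x\le g^*(y)$ for all $x\in P$, $y\in Q$. $\mathbf{ResEnd}(\mathbf{A})$ is the monoid (under composition) of residuated maps on the chain $(A,\le)$ that are also endomorphisms of the monoid $(A,\cdot,1)$. A function $f:K\times K\to A$ is a $2$-cocycle with respect to $\mathbf{K},\mathbf{A},\varphi$ if: (1) $f(k_1,k_2)$ is invertible for all $k_1,k_2\in K$; (2) $f(k,1)=f(1,k)=1$ for all $k\in K$; (3) $\varphi_{1_{\mathbf{K}}}=\mathrm{id}_{\mathbf{A}}$ and $\varphi_{k_1k_2}(a)=f(k_1,k_2)\cdot\varphi_{k_1}\varphi_{k_2}(a)\cdot f(k_1,k_2)^{-1}$ for all $k_1,k_2\in K$, $a\in A$; (4) $f(k_1,k_2k_3)\,\varphi_{k_1}(f(k_2,k_3))=f(k_1k_2,k_3)\,f(k_1,k_2)$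 for all $k_1,k_2,k_3\in K$. $\mathbf{R}_{\varphi,f}$ is the algebra on $R=(A\times K)\cup\{\bot,\top\}$ with multiplication on $A\times K$ $$(a_1,k_1)\cdot(a_2,k_2)=(a_1\,\varphi_{k_1}(a_2)\,f(k_1,k_2)^{-1},\;k_1k_2),$$ identity $(1,1)$, with $\bot$ absorbing for $R$ and $\top$ absorbing for $R\setminus\{\bot\}$, and with lattice order given by $\bot<(a,k)<\top$ for all $(a,k)\in A\times K$, and $(a_1,k_1)\le(a_2,k_2)$ iff $a_1\le_{\mathbf{A}}a_2$ and $k_1=k_2$. *)

theory Defs
  imports Main
begin

text \<open>
  The residuals are written \<open>lres x z\<close> for $x \backslash z$ and \<open>rres z y\<close> for $z / y$.
\<close>

class residuated_lattice = lattice + monoid_mult +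
  fixes lres :: "'a \<Rightarrow> 'a \<Rightarrow> 'a"
    and rres :: "'a \<Rightarrow> 'a \<Rightarrow> 'a"
  assumes lres_iff: "x * y \<le> z \<longleftrightarrow> y \<le> lres x z"
    and rres_iff: "x * y \<le> z \<longleftrightarrow> x \<le> rres z y"

class residuated_chain = residuated_lattice + linorder

class cancel_monoid_mult = monoid_mult +
  assumes left_cancel: "x * y = x * z \<Longrightarrow> y = z"
    and right_cancel: "y * x = z * x \<Longrightarrow> y = z"

definition residuated_map :: "('p::order \<Rightarrow> 'q::order) \<Rightarrow> bool" where
  "residuated_map g \<longleftrightarrow> (\<exists>h. \<forall>x y. g x \<le> y \<longleftrightarrow> x \<le> h y)"

definition ResEnd :: "('a::residuated_chain \<Rightarrow> 'a) set" where
  "ResEnd = {g. residuated_map g \<and> g 1 = 1 \<and> (\<forall>x y. g (x * y) = g x * g y)}"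

definition invertible :: "'a::monoid_mult \<Rightarrow> bool" where
  "invertible x \<longleftrightarrow> (\<exists>y. x * y = 1 \<and> y * x = 1)"

text \<open>Unspecified when \<open>x\<close> is not invertible; the inverse is unique otherwise.\<close>

definition minv :: "'a::monoid_mult \<Rightarrow> 'a" where
  "minv x = (THE y. x * y = 1 \<and> y * x = 1)"

definition two_cocycle ::
  "('k::monoid_mult \<Rightarrow> 'a::monoid_mult \<Rightarrow> 'a) \<Rightarrow> ('k \<Rightarrow> 'k \<Rightarrow> 'a) \<Rightarrow> bool" where
  "two_cocycle \<phi> f \<longleftrightarrow>
     (\<forall>k1 k2. invertible (f k1 k2)) \<and>
     (\<forall>k. f k 1 = 1 \<and> f 1 k = 1) \<and>
     \<phi> 1 = id \<and>
     (\<forall>k1 k2 a. \<phi> (k1 * k2) a = f k1 k2 * \<phi> k1 (\<phi> k2 a) * minv (f k1 k2)) \<and>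
     (\<forall>k1 k2 k3. f k1 (k2 * k3) * \<phi> k1 (f k2 k3) = f (k1 * k2) k3 * f k1 k2)"

datatype ('a, 'k) bt_ext = Bot | Pt 'a 'k | Top

text \<open>
  The algebra $\mathbf{R}_{\varphi,f}$ has carrier \<open>('a, 'k) bt_ext\<close> and the operations below; only
  the multiplication depends on $\varphi$ and $f$. The equations of each function are read from top
  to bottom, so \<open>Bot\<close> absorbs \<open>Top\<close>.
\<close>

fun R_mult :: "('k::monoid_mult \<Rightarrow> 'a::monoid_mult \<Rightarrow> 'a) \<Rightarrow> ('k \<Rightarrow> 'k \<Rightarrow> 'a) \<Rightarrow>
    ('a, 'k) bt_ext \<Rightarrow> ('a, 'k) bt_ext \<Rightarrow> ('a, 'k) bt_ext" where
  "R_mult \<phi> f Bot y = Bot"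
| "R_mult \<phi> f x Bot = Bot"
| "R_mult \<phi> f Top y = Top"
| "R_mult \<phi> f x Top = Top"
| "R_mult \<phi> f (Pt a1 k1) (Pt a2 k2) = Pt (a1 * \<phi> k1 a2 * minv (f k1 k2)) (k1 * k2)"

definition R_one :: "('a::monoid_mult, 'k::monoid_mult) bt_ext" where
  "R_one = Pt 1 1"

fun R_le :: "('a::order, 'k) bt_ext \<Rightarrow> ('a, 'k) bt_ext \<Rightarrow> bool" where
  "R_le Bot y \<longleftrightarrow> True"
| "R_le x Top \<longleftrightarrow> True"
| "R_le (Pt a1 k1) (Pt a2 k2) \<longleftrightarrow> a1 \<le> a2 \<and> k1 = k2"
| "R_le x y \<longleftrightarrow> False"

definition R_less :: "('a::order, 'k) bt_ext \<Rightarrow> ('a, 'k) bt_ext \<Rightarrow> bool" where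
  "R_less x y \<longleftrightarrow> R_le x y \<and> x \<noteq> y"

text \<open>
  Meet and join are the ones determined by \<open>R_le\<close>; that they are indeed the infimum and
  supremum for this order is part of what \<open>class.residuated_lattice\<close> asserts.
\<close>

fun R_inf :: "('a::lattice, 'k) bt_ext \<Rightarrow> ('a, 'k) bt_ext \<Rightarrow> ('a, 'k) bt_ext" where
  "R_inf Bot y = Bot"
| "R_inf x Bot = Bot"
| "R_inf Top y = y"
| "R_inf x Top = x"
| "R_inf (Pt a1 k1) (Pt a2 k2) = (if k1 = k2 then Pt (inf a1 a2) k1 else Bot)"

fun R_sup :: "('a::lattice, 'k) bt_ext \<Rightarrow> ('a, 'k) bt_ext \<Rightarrow> ('a, 'k) bt_ext" where
  "R_sup Top y = Top"
| "R_sup x Top = Top"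
| "R_sup Bot y = y"
| "R_sup x Bot = x"
| "R_sup (Pt a1 k1) (Pt a2 k2) = (if k1 = k2 then Pt (sup a1 a2) k1 else Top)"

end

theory Submission
  imports Defs
begin

text \<open>
  As an ordered set, the algebra is a disjoint union of copies of the chain, one fibre for each
  element of the monoid \<open>K\<close>, with a bottom and a top element added.  This is a lattice: two points
  have a common bound among the points only if they lie in the same fibre.

  The multiplication is that of a crossed product.  Moving \<open>\<phi> (k1 * k2)\<close> past \<open>minv (f k1 k2)\<close>
  turns it into \<open>\<phi> k1 \<circ> \<phi> k2\<close>, so the two bracketings of a triple product differ only in their
  trailing inverses, and these agree by the cocycle equation (\<open>R_mult_assoc_Pt\<close>).

  For the residuals, fix \<open>x\<close> and \<open>z\<close>.  The point of the construction is that the set of all \<open>y\<close> with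
  \<open>x * y \<le> z\<close> is a principal down-set.  If \<open>x\<close> and \<open>z\<close> are points over \<open>k\<close> and \<open>m\<close>, any point \<open>y\<close> in
  this set lies over some \<open>l\<close> with \<open>k * l = m\<close>, and cancellativity makes this \<open>l\<close> unique.  Thus all
  these points belong to one fibre, and there
  \<open>a * \<phi> k b * minv (f k l) \<le> c \<longleftrightarrow> \<phi> k b \<le> lres a (c * f k l)\<close>, because multiplication by an
  invertible element is an order isomorphism; applying the adjoint of \<open>\<phi> k\<close> gives the greatest
  such \<open>b\<close>.  If no such \<open>l\<close> exists, only \<open>Bot\<close> is left.  The other side is the same, without the
  adjoint: there \<open>\<phi> k b\<close> is a constant factor and the residual of the chain suffices.
\<close>

section \<open>Invertible elements\<close>

lemma minv_eqI:
  fixes x :: "'a::monoid_mult"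
  assumes "x * y = 1" "y * x = 1"
  shows "minv x = y"
  unfolding minv_def
proof (rule the_equality)
  fix z assume z: "x * z = 1 \<and> z * x = 1"
  have "z = z * (x * y)" using assms by simp
  also have "\<dots> = y" using z by (simp add: mult.assoc[symmetric])
  finally show "z = y" .
qed (use assms in simp)

lemma
  fixes x :: "'a::monoid_mult"
  assumes "invertible x"
  shows minv_right: "x * minv x = 1" and minv_left: "minv x * x = 1"
  using assms minv_eqI unfolding invertible_def by metis+

lemma minv_one: "minv (1::'a::monoid_mult) = 1"
  by (rule minv_eqI) simp_all

lemma minv_right_assoc:
  fixes x :: "'a::monoid_mult"
  assumes "invertible x"
  shows "x * (minv x * y) = y"
  using minv_right[OF assms] by (simp add: mult.assoc[symmetric])

lemma minv_left_assoc:
  fixes x :: "'a::monoid_mult"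
  assumes "invertible x"
  shows "minv x * (x * y) = y"
  using minv_left[OF assms] by (simp add: mult.assoc[symmetric])

lemma minv_mult:
  fixes x y :: "'a::monoid_mult"
  assumes "invertible x" "invertible y"
  shows "minv (x * y) = minv y * minv x"
  using assms
  by (intro minv_eqI)
    (simp_all add: mult.assoc minv_right_assoc minv_left_assoc minv_right minv_left)

lemma monoid_hom_minv:
  fixes g :: "'a::monoid_mult \<Rightarrow> 'b::monoid_mult"
  assumes "g 1 = 1" and hom: "\<And>x y. g (x * y) = g x * g y" and "invertible x"
  shows "invertible (g x)" and "g (minv x) = minv (g x)"
proof -
  have inv: "g x * g (minv x) = 1" "g (minv x) * g x = 1"
    using assms by (simp_all add: hom[symmetric] minv_right minv_left)
  then show "invertible (g x)"
    unfolding invertible_def by blast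
  from inv show "g (minv x) = minv (g x)"
    by (rule minv_eqI[symmetric])
qed

lemma mult_right_isotone:
  fixes x y z :: "'a::residuated_lattice"
  assumes "x \<le> y"
  shows "x * z \<le> y * z"
proof -
  have "y \<le> rres (y * z) z" by (simp add: rres_iff[symmetric])
  with assms have "x \<le> rres (y * z) z" by (rule order_trans)
  then show ?thesis by (simp add: rres_iff)
qed

text \<open>Multiplication by an invertible element is isotone with isotone inverse, so an inverse
  moves across an inequality as in an ordered group.  This turns the twist in the product of two
  points into a factor on the other side, where the residuals of the chain apply.\<close>

lemma mult_minv_le_iff:
  fixes u x c :: "'a::residuated_lattice"
  assumes "invertible u"
  shows "x * minv u \<le> c \<longleftrightarrow> x \<le> c * u"
proof
  assume "x * minv u \<le> c"
  then have "x * minv u * u \<le> c * u" by (rule mult_right_isotone)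
  then show "x \<le> c * u" using assms by (simp add: mult.assoc minv_left)
next
  assume "x \<le> c * u"
  then have "x * minv u \<le> c * u * minv u" by (rule mult_right_isotone)
  then show "x * minv u \<le> c" using assms by (simp add: mult.assoc minv_right)
qed

section \<open>The lattice reduct\<close>

lemma R_lattice:
  "class.lattice R_inf (R_le :: ('a::lattice, 'k) bt_ext \<Rightarrow> _) R_less R_sup"
proof
  fix x y z :: "('a, 'k) bt_ext"
  show "R_less x y \<longleftrightarrow> R_le x y \<and> \<not> R_le y x"
    unfolding R_less_def by (cases x; cases y) auto
  show "R_le x x" by (cases x) auto
  show "R_le x y \<Longrightarrow> R_le y z \<Longrightarrow> R_le x z"
    by (cases x; cases y; cases z) auto
  show "R_le x y \<Longrightarrow> R_le y x \<Longrightarrow> x = y"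
    by (cases x; cases y) auto
  show "R_le (R_inf x y) x" "R_le (R_inf x y) y"
    by (cases x; cases y; simp)+
  show "R_le x y \<Longrightarrow> R_le x z \<Longrightarrow> R_le x (R_inf y z)"
    by (cases x; cases y; cases z) auto
  show "R_le x (R_sup x y)" "R_le y (R_sup x y)"
    by (cases x; cases y; simp)+
  show "R_le y x \<Longrightarrow> R_le z x \<Longrightarrow> R_le (R_sup y z) x"
    by (cases x; cases y; cases z) auto
qed

section \<open>The monoid reduct\<close>

lemma two_cocycleD:
  assumes "two_cocycle \<phi> f"
  shows "invertible (f k1 k2)" "f k 1 = 1" "f 1 k = 1" "\<phi> 1 = id"
    and "\<phi> (k1 * k2) a = f k1 k2 * \<phi> k1 (\<phi> k2 a) * minv (f k1 k2)"
    and "f k1 (k2 * k3) * \<phi> k1 (f k2 k3) = f (k1 * k2) k3 * f k1 k2"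
  using assms unfolding two_cocycle_def by blast+

text \<open>Both bracketings have the form \<open>a1 * \<phi> k1 a2 * \<phi> k1 (\<phi> k2 a3) * minv u\<close>, where \<open>u\<close> is the left
  side of the cocycle equation for one of them and the right side for the other.\<close>

lemma R_mult_assoc_Pt:
  assumes c: "two_cocycle \<phi> f"
    and one: "\<And>k. \<phi> k 1 = 1" and hom: "\<And>k x y. \<phi> k (x * y) = \<phi> k x * \<phi> k y"
  shows "R_mult \<phi> f (R_mult \<phi> f (Pt a1 k1) (Pt a2 k2)) (Pt a3 k3) =
    R_mult \<phi> f (Pt a1 k1) (R_mult \<phi> f (Pt a2 k2) (Pt a3 k3))"
proof -
  note inv = two_cocycleD(1)[OF c]
  let ?b = "a1 * \<phi> k1 a2 * \<phi> k1 (\<phi> k2 a3)"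
  have "a1 * \<phi> k1 a2 * minv (f k1 k2) * \<phi> (k1 * k2) a3 * minv (f (k1 * k2) k3) =
      ?b * (minv (f k1 k2) * minv (f (k1 * k2) k3))"
    using inv[of k1 k2] by (simp add: two_cocycleD(5)[OF c] mult.assoc minv_left_assoc)
  also have "minv (f k1 k2) * minv (f (k1 * k2) k3) = minv (f (k1 * k2) k3 * f k1 k2)"
    using inv by (simp add: minv_mult)
  also have "\<dots> = minv (f k1 (k2 * k3) * \<phi> k1 (f k2 k3))"
    by (simp add: two_cocycleD(6)[OF c])
  also have "\<dots> = \<phi> k1 (minv (f k2 k3)) * minv (f k1 (k2 * k3))"
    using inv monoid_hom_minv[of "\<phi> k1", OF one hom] by (simp add: minv_mult)
  finally show ?thesis
    by (simp add: hom mult.assoc)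
qed

lemma R_monoid:
  assumes c: "two_cocycle \<phi> f"
    and one: "\<And>k. \<phi> k 1 = 1" and hom: "\<And>k x y. \<phi> k (x * y) = \<phi> k x * \<phi> k y"
  shows "class.monoid_mult R_one (R_mult \<phi> f)"
proof
  fix x y z
  show "R_mult \<phi> f (R_mult \<phi> f x y) z = R_mult \<phi> f x (R_mult \<phi> f y z)"
  proof (cases "\<exists>a1 k1 a2 k2 a3 k3. x = Pt a1 k1 \<and> y = Pt a2 k2 \<and> z = Pt a3 k3")
    case True
    then show ?thesis using R_mult_assoc_Pt[OF assms] by metis
  next
    case False
    then show ?thesis by (cases x; cases y; cases z) auto
  qed
  show "R_mult \<phi> f R_one x = x"
    using two_cocycleD(3,4)[OF c] by (cases x) (auto simp: R_one_def minv_one)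
  show "R_mult \<phi> f x R_one = x"
    using two_cocycleD(2)[OF c] one by (cases x) (auto simp: R_one_def minv_one)
qed

section \<open>Residuals\<close>

text \<open>With a value \<open>Top\<close> or \<open>Bot\<close> among the arguments, the solution set is everything or just
  \<open>Bot\<close>, so the content is in the case of two points.\<close>

lemma R_left_residual_exists:
  fixes \<phi> :: "'k::cancel_monoid_mult \<Rightarrow> 'a::residuated_lattice \<Rightarrow> 'a"
  assumes inv: "\<And>k l. invertible (f k l)" and res: "\<And>k. residuated_map (\<phi> k)"
  shows "\<exists>w. \<forall>y. R_le (R_mult \<phi> f x y) z \<longleftrightarrow> R_le y w"
proof (cases x)
  case Bot
  have "R_le (R_mult \<phi> f x y) z \<longleftrightarrow> R_le y Top" for y
    using Bot by (cases y) auto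
  then show ?thesis by blast
next
  case Top
  have "R_le (R_mult \<phi> f x y) z \<longleftrightarrow> R_le y (if z = Top then Top else Bot)" for y
    using Top by (cases y; cases z) auto
  then show ?thesis by blast
next
  case x: (Pt a k)
  show ?thesis
  proof (cases z)
    case Bot
    have "R_le (R_mult \<phi> f x y) z \<longleftrightarrow> R_le y Bot" for y
      using Bot x by (cases y) auto
    then show ?thesis by blast
  next
    case Top
    have "R_le (R_mult \<phi> f x y) z \<longleftrightarrow> R_le y Top" for y
      using Top by (cases y; cases "R_mult \<phi> f x y") auto
    then show ?thesis by blast
  next
    case z: (Pt c m)
    show ?thesis
    proof (cases "\<exists>l. k * l = m")
      case True
      then obtain l where l: "k * l = m" by blast
      obtain h where h: "\<phi> k b \<le> d \<longleftrightarrow> b \<le> h d" for b d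
        using res[of k] unfolding residuated_map_def by blast
      have fibre: "k * l' = m \<longleftrightarrow> l' = l" for l'
        using l left_cancel by blast
      have "a * \<phi> k b * minv (f k l) \<le> c \<longleftrightarrow> b \<le> h (lres a (c * f k l))" for b
        by (simp only: mult_minv_le_iff[OF inv] lres_iff[symmetric] h[symmetric])
      then have "R_le (R_mult \<phi> f x y) z \<longleftrightarrow> R_le y (Pt (h (lres a (c * f k l))) l)" for y
        using x z fibre by (cases y) auto
      then show ?thesis by blast
    next
      case False
      then have "R_le (R_mult \<phi> f x y) z \<longleftrightarrow> R_le y Bot" for y
        using x z by (cases y) auto
      then show ?thesis by blast
    qed
  qed
qed

lemma R_right_residual_exists:
  fixes \<phi> :: "'k::cancel_monoid_mult \<Rightarrow> 'a::residuated_lattice \<Rightarrow> 'a"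
  assumes inv: "\<And>k l. invertible (f k l)"
  shows "\<exists>w. \<forall>x. R_le (R_mult \<phi> f x y) z \<longleftrightarrow> R_le x w"
proof (cases y)
  case Bot
  have "R_le (R_mult \<phi> f x y) z \<longleftrightarrow> R_le x Top" for x
    using Bot by (cases x) auto
  then show ?thesis by blast
next
  case Top
  have "R_le (R_mult \<phi> f x y) z \<longleftrightarrow> R_le x (if z = Top then Top else Bot)" for x
    using Top by (cases x; cases z) auto
  then show ?thesis by blast
next
  case y: (Pt b l)
  show ?thesis
  proof (cases z)
    case Bot
    have "R_le (R_mult \<phi> f x y) z \<longleftrightarrow> R_le x Bot" for x
      using Bot y by (cases x) auto
    then show ?thesis by blast
  next
    case Top
    have "R_le (R_mult \<phi> f x y) z \<longleftrightarrow> R_le x Top" for x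
      using Top by (cases x; cases "R_mult \<phi> f x y") auto
    then show ?thesis by blast
  next
    case z: (Pt c m)
    show ?thesis
    proof (cases "\<exists>k. k * l = m")
      case True
      then obtain k where k: "k * l = m" by blast
      have fibre: "k' * l = m \<longleftrightarrow> k' = k" for k'
        using k right_cancel by blast
      have "a * \<phi> k b * minv (f k l) \<le> c \<longleftrightarrow> a \<le> rres (c * f k l) (\<phi> k b)" for a
        by (simp only: mult_minv_le_iff[OF inv] rres_iff[symmetric])
      then have "R_le (R_mult \<phi> f x y) z \<longleftrightarrow> R_le x (Pt (rres (c * f k l) (\<phi> k b)) k)" for x
        using y z fibre by (cases x) auto
      then show ?thesis by blast
    next
      case False
      then have "R_le (R_mult \<phi> f x y) z \<longleftrightarrow> R_le x Bot" for x
        using y z by (cases x) auto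
      then show ?thesis by blast
    qed
  qed
qed

section \<open>The residuated lattice\<close>

theorem theorem6p7:
  fixes \<phi> :: "'k::cancel_monoid_mult \<Rightarrow> 'a::residuated_chain \<Rightarrow> 'a"
    and f :: "'k \<Rightarrow> 'k \<Rightarrow> 'a"
  assumes "\<And>k. \<phi> k \<in> ResEnd"
    and "two_cocycle \<phi> f"
  shows "\<exists>R_lres R_rres. class.residuated_lattice
    R_one (R_mult \<phi> f) R_inf R_le R_less R_sup R_lres R_rres"
proof -
  have res: "\<And>k. residuated_map (\<phi> k)" and one: "\<And>k. \<phi> k 1 = 1"
    and hom: "\<And>k x y. \<phi> k (x * y) = \<phi> k x * \<phi> k y"
    using assms(1) unfolding ResEnd_def by blast+
  note inv = two_cocycleD(1)[OF assms(2)]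
  have "\<forall>x z. \<exists>w. \<forall>y. R_le (R_mult \<phi> f x y) z \<longleftrightarrow> R_le y w"
    using R_left_residual_exists[of f \<phi>, OF inv res] by blast
  then obtain L where L: "\<And>x y z. R_le (R_mult \<phi> f x y) z \<longleftrightarrow> R_le y (L x z)"
    by metis
  have "\<forall>z y. \<exists>w. \<forall>x. R_le (R_mult \<phi> f x y) z \<longleftrightarrow> R_le x w"
    using R_right_residual_exists[of f \<phi>, OF inv] by blast
  then obtain R where R: "\<And>x y z. R_le (R_mult \<phi> f x y) z \<longleftrightarrow> R_le x (R z y)"
    by metis
  have "class.residuated_lattice R_one (R_mult \<phi> f) R_inf R_le R_less R_sup L R"
    unfolding class.residuated_lattice_def class.residuated_lattice_axioms_def
    using R_lattice R_monoid[OF assms(2) one hom] L R by (intro conjI allI)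
  then show ?thesis by blast
qed

end
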